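(* Let $k$ be a field of prime characteristic $p$. Let $L$ be a finite group with order divisible by $p$, and let $\alpha\in Z^2(L,k^{\times})$ be a (normalized) $2$-cocycle, where $L$ acts trivially on $k^\times$. Let $P$ be a Sylow $p$-subgroup of $L$. Assume that one of the following statements is true: (i) $L$ is non-$p$-perfect; (ii) $P$ is normal in $L$; (iii) $Z(P)$ is not included in $P'$; (iv) the exponent of $P'$ is strictly smaller than the exponent of $P$; (v) $P$ is metacyclic. Then $L_{C(p)}\cap L_{\alpha}^{\circ}\neq\emptyset$.
   Context: $Z^2(L,k^\times)$ (trivial action of $L$ on the multiplicative group $k^\times$) is the set of maps $\alpha:L\times L\to k^\times$ with $\alpha(xy,z)\alpha(x,y)=\alpha(x,yz)\alpha(y,z)$ for all $x,y,z\in L$; $\alpha$ is normalized if $\alpha(1,1)=1$. An element $x\in L$ is $\alpha$-regular if $\alpha(x,y)=\alpha(y,x)$ for all $y\in C_L(x)$; $L_\alpha^\circ$ denotes the set of $\alpha$-regular elements of $L$. $L_{C(p)}$ denotes the set of all $x\in L$ such that $p$ divides the index $|C_L(x):(C_L(x))'|$, where $C_L(x)$ is the centralizer of $x$ in $L$ and $H'$ denotes the commutator subgroup of $H$. $L$ is non-$p$-perfect if $\mathcal{O}^p(L)<L$, where $\mathcal{O}^p(L)$ is the smallest normal subgroup of $L$ with $p$-power index. *)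

theory Defs
  imports "HOL-Algebra.Algebra"
begin

text \<open>The characteristic of a ring is the additive order of its unit; \<^const>\<open>group.ord\<close>
  gives 0 when that order is infinite.\<close>

definition ring_characteristic :: "('k, 'c) ring_scheme \<Rightarrow> nat" where
  "ring_characteristic K = group.ord (add_monoid K) \<one>\<^bsub>K\<^esub>"

text \<open>Trivial action of \<open>L\<close> on \<open>A\<close>. Values outside \<open>carrier L \<times> carrier L\<close> are unconstrained.\<close>

definition two_cocycles ::
  "('a, 'b) monoid_scheme \<Rightarrow> ('k, 'c) monoid_scheme \<Rightarrow> ('a \<times> 'a \<Rightarrow> 'k) set" where
  "two_cocycles L A =
    {\<alpha> \<in> carrier L \<times> carrier L \<rightarrow> carrier A.
      \<forall>x\<in>carrier L. \<forall>y\<in>carrier L. \<forall>z\<in>carrier L.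
        \<alpha> (x \<otimes>\<^bsub>L\<^esub> y, z) \<otimes>\<^bsub>A\<^esub> \<alpha> (x, y) = \<alpha> (x, y \<otimes>\<^bsub>L\<^esub> z) \<otimes>\<^bsub>A\<^esub> \<alpha> (y, z)}"

definition normalized_cocycle ::
  "('a, 'b) monoid_scheme \<Rightarrow> ('k, 'c) monoid_scheme \<Rightarrow> ('a \<times> 'a \<Rightarrow> 'k) \<Rightarrow> bool" where
  "normalized_cocycle L A \<alpha> \<longleftrightarrow> \<alpha> (\<one>\<^bsub>L\<^esub>, \<one>\<^bsub>L\<^esub>) = \<one>\<^bsub>A\<^esub>"

definition elt_centralizer :: "('a, 'b) monoid_scheme \<Rightarrow> 'a \<Rightarrow> 'a set" where
  "elt_centralizer L x = {y \<in> carrier L. x \<otimes>\<^bsub>L\<^esub> y = y \<otimes>\<^bsub>L\<^esub> x}"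

definition regular_elements :: "('a, 'b) monoid_scheme \<Rightarrow> ('a \<times> 'a \<Rightarrow> 'k) \<Rightarrow> 'a set" where
  "regular_elements L \<alpha> = {x \<in> carrier L. \<forall>y\<in>elt_centralizer L x. \<alpha> (x, y) = \<alpha> (y, x)}"

definition subgroup_index :: "('a, 'b) monoid_scheme \<Rightarrow> 'a set \<Rightarrow> nat" where
  "subgroup_index G H = card (rcosets\<^bsub>G\<^esub> H)"

definition centralizer_p_elements :: "nat \<Rightarrow> ('a, 'b) monoid_scheme \<Rightarrow> 'a set" where
  "centralizer_p_elements p L =
    {x \<in> carrier L.
      p dvd subgroup_index (L\<lparr>carrier := elt_centralizer L x\<rparr>) (derived L (elt_centralizer L x))}"

text \<open>\<open>LEAST\<close> refers to the inclusion order on subsets; the minimum exists for finite groups,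
  see \<open>p_residual_least\<close> below.\<close>

definition p_residual :: "nat \<Rightarrow> ('a, 'b) monoid_scheme \<Rightarrow> 'a set" where
  "p_residual p L = (LEAST N. N \<lhd> L \<and> (\<exists>n. subgroup_index L N = p ^ n))"

lemma (in group) p_power_index_inter:
  assumes fin: "finite (carrier G)" and p: "Factorial_Ring.prime p"
    and M: "M \<lhd> G" "subgroup_index G M = p ^ m"
    and N: "N \<lhd> G" "subgroup_index G N = p ^ n"
  shows "\<exists>k. subgroup_index G (M \<inter> N) = p ^ k"
proof -
  interpret M: normal M G by fact
  interpret N: normal N G by fact
  let ?D = "(G Mod M) \<times>\<times> (G Mod N)"
  let ?h = "\<lambda>x. (M #> x, N #> x)"
  have gD: "group ?D"
    using DirProd_group M.factorgroup_is_group N.factorgroup_is_group by blast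
  have "?h \<in> hom G ?D"
    using M.r_coset_hom_Mod N.r_coset_hom_Mod by (auto simp: hom_def)
  then interpret h: group_hom G ?D ?h
    using gD group_axioms by (simp add: group_hom_def group_hom_axioms_def)
  have ker: "kernel G ?D ?h = M \<inter> N"
  proof -
    have "M #> x = M \<longleftrightarrow> x \<in> M" "N #> x = N \<longleftrightarrow> x \<in> N" if "x \<in> carrier G" for x
      using coset_join1[OF _ that M.subgroup_axioms] coset_join1[OF _ that N.subgroup_axioms]
        M.rcos_const[OF group_axioms] N.rcos_const[OF group_axioms] by blast+
    then show ?thesis
      using M.subset by (auto simp: kernel_def FactGroup_def)
  qed
  have "order ?D = p ^ (m + n)"
    using M N by (simp add: order_def FactGroup_def subgroup_index_def power_add card_cartesian_product)
  moreover have "card (?h ` carrier G) dvd order ?D"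
    by (subst group.lagrange[OF gD h.img_is_subgroup, symmetric]) (rule dvd_triv_right)
  ultimately obtain k where k: "card (?h ` carrier G) = p ^ k"
    by (auto simp: divides_primepow_nat[OF p])
  have "subgroup_index G (M \<inter> N) = card (?h ` carrier G)"
  proof -
    let ?I = "?D\<lparr>carrier := ?h ` carrier G\<rparr>"
    have gI: "group ?I"
      using group.subgroup_imp_group[OF gD h.img_is_subgroup] .
    have "?h \<in> hom G ?I"
      using h.homh by (auto simp: hom_def)
    then interpret i: group_hom G ?I ?h
      using gI group_axioms by (simp add: group_hom_def group_hom_axioms_def)
    have "kernel G ?I ?h = M \<inter> N"
      using ker by (simp add: kernel_def)
    then have "bij_betw (\<lambda>Y. the_elem (?h ` Y)) (carrier (G Mod (M \<inter> N))) (?h ` carrier G)"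
      using i.FactGroup_iso_set by (simp add: iso_def)
    then show ?thesis
      by (simp add: bij_betw_same_card FactGroup_def subgroup_index_def)
  qed
  then show ?thesis
    using k by (intro exI) (rule trans)
qed

lemma (in group) p_residual_least:
  assumes fin: "finite (carrier G)" and p: "Factorial_Ring.prime p"
  shows "p_residual p G \<lhd> G" and "\<exists>n. subgroup_index G (p_residual p G) = p ^ n"
    and "\<And>N n. N \<lhd> G \<Longrightarrow> subgroup_index G N = p ^ n \<Longrightarrow> p_residual p G \<subseteq> N"
proof -
  let ?Q = "\<lambda>N. N \<lhd> G \<and> (\<exists>n. subgroup_index G N = p ^ n)"
  have "card (rcosets (carrier G)) * card (carrier G) = card (carrier G)"
    using lagrange[OF subgroup_self] by (simp add: order_def)
  then have "subgroup_index G (carrier G) = p ^ 0"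
    using fin one_closed by (auto simp: subgroup_index_def)
  then have top: "?Q (carrier G)"
    using normal_self by blast
  obtain N where N: "?Q N" and min: "\<And>M. ?Q M \<Longrightarrow> card N \<le> card M"
    using ex_has_least_nat[of ?Q "carrier G" card] top by blast
  have least: "N \<subseteq> M" if M: "?Q M" for M
  proof -
    have "?Q (N \<inter> M)"
      using p_power_index_inter[OF fin p] normal_subgroup_intersect N M by blast
    then have "card N \<le> card (N \<inter> M)" by (rule min)
    moreover have "finite N"
      using N fin by (meson finite_subset normal_imp_subgroup subgroup.subset)
    ultimately show ?thesis
      by (metis card_seteq inf.cobounded1 inf.cobounded2)
  qed
  have "p_residual p G = N"
    unfolding p_residual_def using N least by (intro Least_equality) auto
  with N least show "p_residual p G \<lhd> G" "\<exists>n. subgroup_index G (p_residual p G) = p ^ n"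
    "\<And>N n. N \<lhd> G \<Longrightarrow> subgroup_index G N = p ^ n \<Longrightarrow> p_residual p G \<subseteq> N"
    by blast+
qed

definition non_p_perfect :: "nat \<Rightarrow> ('a, 'b) monoid_scheme \<Rightarrow> bool" where
  "non_p_perfect p L \<longleftrightarrow> p_residual p L \<subset> carrier L"

definition sylow_subgroup :: "nat \<Rightarrow> 'a set \<Rightarrow> ('a, 'b) monoid_scheme \<Rightarrow> bool" where
  "sylow_subgroup p P L \<longleftrightarrow> subgroup P L \<and> card P = p ^ multiplicity p (order L)"

definition group_center :: "('a, 'b) monoid_scheme \<Rightarrow> 'a set" where
  "group_center G = {z \<in> carrier G. \<forall>y\<in>carrier G. z \<otimes>\<^bsub>G\<^esub> y = y \<otimes>\<^bsub>G\<^esub> z}"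

definition group_exponent :: "('a, 'b) monoid_scheme \<Rightarrow> nat" where
  "group_exponent G = (LEAST n. 0 < n \<and> (\<forall>x\<in>carrier G. x [^]\<^bsub>G\<^esub> n = \<one>\<^bsub>G\<^esub>))"

definition metacyclic :: "('a, 'b) monoid_scheme \<Rightarrow> bool" where
  "metacyclic G \<longleftrightarrow>
    (\<exists>N. N \<lhd> G \<and> cyclic_group (G\<lparr>carrier := N\<rparr>) \<and> cyclic_group (G Mod N))"

end

theory Submission
  imports Defs "HOL-Number_Theory.Residues"
begin

text \<open>
  Two observations reduce the theorem to a statement about Sylow subgroups.

  First, every element \<open>x\<close> of \<open>p\<close>-power order is \<open>\<alpha>\<close>-regular. For a fixed \<open>y\<close> the quotient
  \<open>\<alpha>(z, y) / \<alpha>(y, z)\<close> is multiplicative in \<open>z \<in> C\<^sub>L(y)\<close>: in the twisted group algebra it is the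
  scalar by which the two products of the basis elements of \<open>z\<close> and \<open>y\<close> differ. Its
  value at a \<open>p\<close>-element is therefore a root of unity of \<open>p\<close>-power order, and a field of
  characteristic \<open>p\<close> has only the trivial one.

  Second, let \<open>x\<close> be a \<open>p\<close>-element, \<open>C = C\<^sub>L(x)\<close> and \<open>Q\<close> a Sylow \<open>p\<close>-subgroup of \<open>C\<close>, so that
  \<open>x\<close> is a central element of \<open>C\<close> lying in \<open>Q\<close>. The transfer \<open>C \<rightarrow> Q/Q'\<close> sends the central
  element \<open>x\<close> to the class of \<open>x\<close> raised to the power \<open>|C : Q|\<close>, which is prime to \<open>p\<close>. Hence if
  \<open>x \<notin> Q'\<close>, then \<open>x\<close> has a nontrivial image of \<open>p\<close>-power order in an abelian quotient of \<open>C\<close>, and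
  \<open>p\<close> divides \<open>|C : C'|\<close>. As \<open>Q\<close> is conjugate into \<open>P\<close>, it suffices to find \<open>x \<in> P\<close> without
  conjugates in \<open>P'\<close>.

  Each of the five hypotheses leads to a suitable \<open>x\<close>. If \<open>L\<close> has a nontrivial \<open>p\<close>-quotient, then
  \<open>x = 1\<close> works directly, because nontrivial \<open>p\<close>-groups are not perfect. If \<open>P\<close> is normal in \<open>L\<close>, so
  is \<open>P'\<close>, and any \<open>x \<in> P - P'\<close> has no conjugate in \<open>P'\<close>. If \<open>x \<in> Z(P) - P'\<close>, then \<open>P \<le> C\<^sub>L(x)\<close>
  and the transfer applies with \<open>Q = P\<close>. If the exponent \<open>e\<close> of \<open>P'\<close> is smaller than that of \<open>P\<close>,
  some \<open>x \<in> P\<close> has \<open>x\<^sup>e \<noteq> 1\<close>, a property that conjugation preserves and that excludes \<open>P'\<close>.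
  Finally, let \<open>P\<close> be metacyclic, with cyclic normal subgroup \<open>N = \<langle>a\<rangle>\<close> and cyclic quotient. Then
  \<open>P\<close> acts on \<open>N\<close> by power maps whose exponents are congruent to \<open>1\<close> modulo \<open>p\<close>, which puts \<open>P'\<close>
  inside \<open>\<langle>a\<^sup>p\<rangle>\<close>. So \<open>P'\<close> has smaller exponent than \<open>P\<close>, also when \<open>N\<close> and hence \<open>P'\<close> is trivial.
\<close>

section \<open>Roots of unity in characteristic \<open>p\<close>\<close>

lemma (in cring) binomial_one:
  assumes v: "v \<in> carrier R"
  shows "(\<one> \<oplus> v) [^] n = (\<Oplus>i\<in>{..n}. add_pow R (n choose i) (v [^] i))"
proof (induction n)
  case 0
  then show ?case using v by simp
next
  case (Suc n)
  let ?a = "\<lambda>i. add_pow R (n choose i) (v [^] i)"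
  let ?b = "\<lambda>i. add_pow R (n choose i) (v [^] Suc i)"
  have a: "?a \<in> A \<rightarrow> carrier R" and b: "?b \<in> A \<rightarrow> carrier R"
    and c: "(\<lambda>i. ?a (Suc i)) \<in> A \<rightarrow> carrier R" for A
    using v by auto
  have bc: "add_pow R (Suc n choose Suc i) (v [^] Suc i) = ?b i \<oplus> ?a (Suc i)" for i
    using v by (simp add: add.nat_pow_mult)
  have "(\<one> \<oplus> v) [^] Suc n = (\<Oplus>i\<in>{..n}. ?a i) \<otimes> (\<one> \<oplus> v)"
    using Suc by simp
  also have "\<dots> = (\<Oplus>i\<in>{..n}. ?a i) \<oplus> (\<Oplus>i\<in>{..n}. ?a i) \<otimes> v"
    using v a by (simp add: r_distr)
  also have "(\<Oplus>i\<in>{..n}. ?a i) \<otimes> v = (\<Oplus>i\<in>{..n}. ?a i \<otimes> v)"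
    using v a by (intro finsum_ldistr) auto
  also have "\<dots> = (\<Oplus>i\<in>{..n}. ?b i)"
    using v by (intro finsum_cong') (auto simp: add_pow_ldistr)
  also have "(\<Oplus>i\<in>{..n}. ?a i) = (\<Oplus>i\<in>{..Suc n}. ?a i)"
    using v a by (simp add: binomial_eq_0)
  also have "(\<Oplus>i\<in>{..Suc n}. ?a i) = (\<Oplus>i\<in>{..n}. ?a (Suc i)) \<oplus> \<one>"
    using v a by (subst finsum_Suc2) auto
  finally have "(\<one> \<oplus> v) [^] Suc n = (\<Oplus>i\<in>{..n}. ?b i \<oplus> ?a (Suc i)) \<oplus> \<one>"
    using finsum_addf[OF b c, of "{..n}"] finsum_closed[OF b, of "{..n}"] finsum_closed[OF c, of "{..n}"]
    by (simp only: a_ac one_closed a_closed)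
  also have "\<dots> = (\<Oplus>i\<in>{..n}. add_pow R (Suc n choose Suc i) (v [^] Suc i)) \<oplus> \<one>"
    by (simp only: bc)
  also have "\<dots> = (\<Oplus>i\<in>{..Suc n}. add_pow R (Suc n choose i) (v [^] i))"
    using v by (subst finsum_Suc2) auto
  finally show ?case .
qed

text \<open>With \<open>u = 1 + v\<close> the binomial theorem reads \<open>1 = u\<^sup>p = 1 + v\<^sup>p\<close>, because \<open>p\<close> divides the inner
  binomial coefficients. So \<open>v\<close> is nilpotent, hence zero.\<close>

lemma (in field) pow_prime_char_eq_one:
  assumes p: "Factorial_Ring.prime p" and char: "ring_characteristic R = p"
    and u: "u \<in> carrier R" "u [^] p = \<one>"
  shows "u = \<one>"
proof -
  define v where "v = u \<ominus> \<one>"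
  have v: "v \<in> carrier R" and uv: "u = \<one> \<oplus> v"
    using u(1) a_lcomm[of \<one> u "\<ominus> \<one>"] unfolding v_def by (auto simp: minus_eq r_neg)
  have p0: "add_pow R p \<one> = \<zero>"
    using add.pow_ord_eq_1[OF one_closed] unfolding char[unfolded ring_characteristic_def] .
  have multiple: "add_pow R k w = \<zero>" if "p dvd k" and w: "w \<in> carrier R" for k w
  proof -
    from that obtain q where q: "k = p * q" by blast
    have "add_pow R k w = add_pow R p \<one> \<otimes> add_pow R q w"
      using w unfolding q by (simp add: add_pow_ldistr add.nat_pow_pow mult.commute)
    then show ?thesis using w p0 by simp
  qed
  \<comment> \<open>Two summands are split off, the first and the last, so \<open>p\<close> is written as a double successor.\<close>
  define m where "m = p - 2"
  have m: "p = Suc (Suc m)"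
    using prime_gt_1_nat[OF p] by (simp add: m_def)
  have mid: "(\<Oplus>i\<in>{..m}. add_pow R (p choose Suc i) (v [^] Suc i)) = (\<Oplus>i\<in>{..m}. \<zero>)"
  proof (intro finsum_cong')
    fix i assume "i \<in> {..m}"
    then have "p dvd (p choose Suc i)"
      using p m by (intro dvd_choose_prime) auto
    then show "add_pow R (p choose Suc i) (v [^] Suc i) = \<zero>"
      using v by (intro multiple) auto
  qed auto
  have "u [^] p = (\<Oplus>i\<in>{..Suc (Suc m)}. add_pow R (p choose i) (v [^] i))"
    unfolding uv binomial_one[OF v] by (simp only: m)
  also have "\<dots> = v [^] p \<oplus> (\<Oplus>i\<in>{..Suc m}. add_pow R (p choose i) (v [^] i))"
    using v by (subst finsum_Suc) (auto simp: m)
  also have "(\<Oplus>i\<in>{..Suc m}. add_pow R (p choose i) (v [^] i))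
      = (\<Oplus>i\<in>{..m}. add_pow R (p choose Suc i) (v [^] Suc i)) \<oplus> \<one>"
    using v by (subst finsum_Suc2) auto
  also have "\<dots> = \<one>"
    unfolding mid by simp
  finally have "v [^] p \<oplus> \<one> = \<zero> \<oplus> \<one>"
    using u by simp
  then have "v [^] p = \<zero>"
    using v by (simp only: add.right_cancel nat_pow_closed one_closed zero_closed)
  moreover have "v [^] k = \<zero> \<Longrightarrow> v = \<zero>" for k :: nat
    by (induction k) (use v integral in auto)
  ultimately have "v = \<zero>" by blast
  then show ?thesis using uv by simp
qed

lemma (in field) unit_pow_prime_power_eq_one:
  assumes p: "Factorial_Ring.prime p" and char: "ring_characteristic R = p"
    and u: "u \<in> carrier (units_of R)" "u [^]\<^bsub>units_of R\<^esub> (p ^ n) = \<one>\<^bsub>units_of R\<^esub>"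
  shows "u = \<one>\<^bsub>units_of R\<^esub>"
proof -
  have uR: "u \<in> carrier R" "u \<in> Units R"
    using u(1) by (auto simp: units_of_carrier)
  have "u [^] (p ^ n) = \<one> \<Longrightarrow> u = \<one>"
  proof (induction n)
    case (Suc n)
    have "(u [^] (p ^ n)) [^] p = \<one>"
      using uR Suc.prems by (simp add: nat_pow_pow mult.commute)
    then show ?case
      using Suc.IH pow_prime_char_eq_one[OF p char nat_pow_closed[OF uR(1)]] by blast
  qed (use uR in simp)
  then show ?thesis
    using u(2) uR by (simp add: units_of_pow units_of_one)
qed

section \<open>Regularity of \<open>p\<close>-elements\<close>

text \<open>The ratio \<open>f z = \<alpha>(z, y) / \<alpha>(y, z)\<close> is multiplicative on the centralizer of \<open>y\<close>, so \<open>f x\<close> is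
  killed by every exponent that kills \<open>x\<close>. In the multiplicative group of a field of
  characteristic \<open>p\<close> the condition on \<open>q\<close> holds for the powers of \<open>p\<close>.\<close>

lemma (in group) p_element_regular:
  assumes A: "comm_group A" and \<alpha>: "\<alpha> \<in> two_cocycles G A"
    and no_p: "\<And>u. u \<in> carrier A \<Longrightarrow> u [^]\<^bsub>A\<^esub> q = \<one>\<^bsub>A\<^esub> \<Longrightarrow> u = \<one>\<^bsub>A\<^esub>"
    and x: "x \<in> carrier G" "x [^] (q::nat) = \<one>"
  shows "x \<in> regular_elements G \<alpha>"
proof -
  interpret A: comm_group A by fact
  have val: "\<alpha> (g, h) \<in> carrier A" if "g \<in> carrier G" "h \<in> carrier G" for g h
    using that \<alpha> by (auto simp: two_cocycles_def)
  have coc: "\<alpha> (g \<otimes> h, k) \<otimes>\<^bsub>A\<^esub> \<alpha> (g, h) = \<alpha> (g, h \<otimes> k) \<otimes>\<^bsub>A\<^esub> \<alpha> (h, k)"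
    if "g \<in> carrier G" "h \<in> carrier G" "k \<in> carrier G" for g h k
    using that \<alpha> by (auto simp: two_cocycles_def)
  have "\<alpha> (x, y) = \<alpha> (y, x)" if y: "y \<in> elt_centralizer G x" for y
  proof -
    have yG: "y \<in> carrier G" and xy: "x \<otimes> y = y \<otimes> x"
      using y by (auto simp: elt_centralizer_def)
    define f where "f z = \<alpha> (z, y) \<otimes>\<^bsub>A\<^esub> inv\<^bsub>A\<^esub> \<alpha> (y, z)" for z
    have fA: "f z \<in> carrier A" if "z \<in> carrier G" for z
      using that val yG by (simp add: f_def)
    have f_mult: "f (z \<otimes> w) = f z \<otimes>\<^bsub>A\<^esub> f w"
      if z: "z \<in> carrier G" "z \<otimes> y = y \<otimes> z" and w: "w \<in> carrier G" "w \<otimes> y = y \<otimes> w" for z w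
    proof -
      note [simp] = val yG z w
      let ?m = "(\<otimes>\<^bsub>A\<^esub>)"
      have 1: "?m (\<alpha> (z \<otimes> w, y)) (\<alpha> (z, w)) = ?m (\<alpha> (z, y \<otimes> w)) (\<alpha> (w, y))"
        using coc[of z w y] by simp
      have 2: "?m (\<alpha> (y \<otimes> z, w)) (\<alpha> (y, z)) = ?m (\<alpha> (y, z \<otimes> w)) (\<alpha> (z, w))"
        using coc[of y z w] by simp
      have 3: "?m (\<alpha> (y \<otimes> z, w)) (\<alpha> (z, y)) = ?m (\<alpha> (z, y \<otimes> w)) (\<alpha> (y, w))"
        using coc[of z y w] by simp
      \<comment> \<open>Naming the nine values keeps simplification from rewriting the products inside them.
        The three cocycle identities combine so that \<open>b\<close>, \<open>c\<close> and \<open>e\<close> cancel.\<close>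
      define a b c d e g h i where abbr: "a = \<alpha> (z \<otimes> w, y)" "b = \<alpha> (z, w)" "c = \<alpha> (z, y \<otimes> w)"
        "d = \<alpha> (w, y)" "e = \<alpha> (y \<otimes> z, w)" "g = \<alpha> (y, z)" "h = \<alpha> (y, z \<otimes> w)" "i = \<alpha> (z, y)"
      define j where "j = \<alpha> (y, w)"
      have C[simp]: "a \<in> carrier A" "b \<in> carrier A" "c \<in> carrier A" "d \<in> carrier A" "e \<in> carrier A"
         "g \<in> carrier A" "h \<in> carrier A" "i \<in> carrier A" "j \<in> carrier A"
        by (auto simp: abbr j_def)
      have E: "?m a b = ?m c d" "?m e g = ?m h b" "?m e i = ?m c j"
        using 1 2 3 by (auto simp: abbr j_def)
      have "?m (?m a (?m g j)) (?m (?m b e) c) = ?m (?m a b) (?m (?m e g) (?m c j))"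
        by (simp add: A.m_ac)
      also have "\<dots> = ?m (?m c d) (?m (?m h b) (?m e i))"
        by (simp only: E)
      also have "\<dots> = ?m (?m h (?m i d)) (?m (?m b e) c)"
        by (simp add: A.m_ac)
      finally have "?m a (?m g j) = ?m h (?m i d)"
        by (simp add: A.r_cancel)
      then have "a = ?m (?m h (?m i d)) (inv\<^bsub>A\<^esub> (?m g j))"
        by (simp add: A.inv_solve_right)
      then have "?m a (inv\<^bsub>A\<^esub> h) = ?m (?m h (inv\<^bsub>A\<^esub> h)) (?m (?m i d) (inv\<^bsub>A\<^esub> (?m g j)))"
        by (simp only: A.m_ac A.m_closed A.inv_closed C)
      then have "?m a (inv\<^bsub>A\<^esub> h) = ?m (?m i (inv\<^bsub>A\<^esub> g)) (?m d (inv\<^bsub>A\<^esub> j))"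
        by (simp add: A.inv_mult A.m_ac)
      then show ?thesis by (simp add: f_def abbr j_def)
    qed
    have f_one: "f \<one> = \<one>\<^bsub>A\<^esub>"
      using f_mult[of \<one> \<one>] fA[of \<one>] yG by (simp add: A.r_cancel_one')
    have x_pow: "x [^] n \<otimes> y = y \<otimes> x [^] n" for n :: nat
      using x yG xy by (metis group_commutes_pow)
    have "f (x [^] n) = f x [^]\<^bsub>A\<^esub> n" for n :: nat
    proof (induction n)
      case (Suc n)
      then show ?case using f_mult[OF _ x_pow x(1) xy, of n] x(1) by simp
    qed (simp add: f_one)
    then have "f x [^]\<^bsub>A\<^esub> q = \<one>\<^bsub>A\<^esub>"
      using x(2) f_one by metis
    then have "f x = \<one>\<^bsub>A\<^esub>"
      using no_p fA x(1) by blast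
    then show ?thesis
      using val[OF x(1) yG] val[OF yG x(1)] by (simp add: f_def A.inv_solve_right')
  qed
  then show ?thesis using x(1) by (simp add: regular_elements_def)
qed

section \<open>Transfer\<close>

text \<open>The transfer of \<open>f\<close> from \<open>Q\<close> to \<open>G\<close>: each right coset \<open>c\<close> contributes the element \<open>t g t'\<^sup>-\<^sup>1\<close> of \<open>Q\<close>,
  where \<open>t\<close> and \<open>t'\<close> are the chosen representatives of \<open>c\<close> and \<open>c g\<close>.\<close>

definition group_transfer ::
  "('a, 'b) monoid_scheme \<Rightarrow> 'a set \<Rightarrow> ('c, 'd) monoid_scheme \<Rightarrow> ('a \<Rightarrow> 'c) \<Rightarrow> 'a \<Rightarrow> 'c" where
  "group_transfer G Q A f g =
    finprod A (\<lambda>c. f ((SOME t. t \<in> c) \<otimes>\<^bsub>G\<^esub> g \<otimes>\<^bsub>G\<^esub> inv\<^bsub>G\<^esub> (SOME t. t \<in> c #>\<^bsub>G\<^esub> g))) (rcosets\<^bsub>G\<^esub> Q)"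

lemma (in group) rcoset_mult_closed:
  assumes "subgroup Q G" "c \<in> rcosets Q" "g \<in> carrier G"
  shows "c #> g \<in> rcosets Q"
  using assms subgroup.subset[OF assms(1)] by (auto simp: RCOSETS_def coset_mult_assoc)

lemma (in group) rcoset_mult_mult:
  assumes "subgroup Q G" "c \<in> rcosets Q" "g \<in> carrier G" "h \<in> carrier G"
  shows "c #> g #> h = c #> (g \<otimes> h)"
  using assms by (simp add: coset_mult_assoc subgroup.rcosets_carrier is_group)

lemma (in group) rcoset_mult_bij:
  assumes Q: "subgroup Q G" and g: "g \<in> carrier G"
  shows "bij_betw (\<lambda>c. c #> g) (rcosets Q) (rcosets Q)"
proof (rule bij_betw_byWitness[where f' = "\<lambda>c. c #> inv g"])
qed (use rcoset_mult_mult[OF Q] subgroup.rcosets_carrier[OF Q is_group] g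
  in \<open>auto simp: rcoset_mult_closed[OF Q]\<close>)

lemma (in group) rcoset_rep:
  assumes Q: "subgroup Q G" and c: "c \<in> rcosets Q"
  shows "(SOME t. t \<in> c) \<in> carrier G" and "c = Q #> (SOME t. t \<in> c)"
proof -
  obtain g where g: "g \<in> carrier G" "c = Q #> g"
    using c by (auto simp: RCOSETS_def)
  then have t: "(SOME t. t \<in> c) \<in> c"
    using rcos_self[OF g(1) Q] by (metis someI)
  then show "(SOME t. t \<in> c) \<in> carrier G"
    using subgroup.rcosets_carrier[OF Q is_group c] by blast
  show "c = Q #> (SOME t. t \<in> c)"
    using repr_independence[OF t[unfolded g(2)] g(1) Q] unfolding g(2) .
qed

lemma (in group) transfer_factor_closed:
  assumes Q: "subgroup Q G" and c: "c \<in> rcosets Q" and g: "g \<in> carrier G"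
  shows "(SOME t. t \<in> c) \<otimes> g \<otimes> inv (SOME t. t \<in> c #> g) \<in> Q"
proof -
  note c' = rcoset_mult_closed[OF Q c g]
  have "c #> g = Q #> ((SOME t. t \<in> c) \<otimes> g)"
    using rcoset_rep[OF Q c] g subgroup.subset[OF Q] by (metis coset_mult_assoc)
  then have "(SOME t. t \<in> c) \<otimes> g \<in> Q #> (SOME t. t \<in> c #> g)"
    using rcoset_rep[OF Q c'] rcoset_rep(1)[OF Q c] g rcos_self[OF _ Q] by (metis m_closed)
  then show ?thesis
    using subgroup.rcos_module_imp[OF Q is_group] rcoset_rep(1)[OF Q c'] by blast
qed

text \<open>The factor at \<open>c\<close> of a product \<open>g h\<close> is the factor of \<open>g\<close> at \<open>c\<close> times the factor of \<open>h\<close> at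
  \<open>c g\<close>; right multiplication by \<open>g\<close> permutes the cosets, and the order of the factors is irrelevant
  in the abelian target.\<close>

lemma (in group) group_transfer_hom:
  assumes Q: "subgroup Q G" and A: "comm_group A" and f: "f \<in> hom (G\<lparr>carrier := Q\<rparr>) A"
  shows "group_transfer G Q A f \<in> hom G A"
proof -
  interpret A: comm_group A by fact
  let ?r = "\<lambda>c. SOME t. t \<in> c"
  define F where "F g c = f (?r c \<otimes> g \<otimes> inv (?r (c #> g)))" for g c
  have transfer: "group_transfer G Q A f g = finprod A (F g) (rcosets Q)" for g
    unfolding group_transfer_def F_def ..
  have F: "F g c \<in> carrier A" if "g \<in> carrier G" "c \<in> rcosets Q" for g c
    using transfer_factor_closed[OF Q that(2,1)] f by (auto simp: F_def hom_def)
  show ?thesis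
  proof (rule homI)
    fix g assume g: "g \<in> carrier G"
    then show "group_transfer G Q A f g \<in> carrier A"
      unfolding transfer using F by (intro A.finprod_closed) auto
    fix h assume h: "h \<in> carrier G"
    have cocycle: "F (g \<otimes> h) c = F g c \<otimes>\<^bsub>A\<^esub> F h (c #> g)" if c: "c \<in> rcosets Q" for c
    proof -
      note cg = rcoset_mult_closed[OF Q c g]
      note cgh = rcoset_mult_closed[OF Q cg h]
      note rep = rcoset_rep(1)[OF Q c] rcoset_rep(1)[OF Q cg] rcoset_rep(1)[OF Q cgh]
      have "F g c \<otimes>\<^bsub>A\<^esub> F h (c #> g)
        = f ((?r c \<otimes> g \<otimes> inv (?r (c #> g))) \<otimes> (?r (c #> g) \<otimes> h \<otimes> inv (?r (c #> g #> h))))"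
        using transfer_factor_closed[OF Q c g] transfer_factor_closed[OF Q cg h] f
        by (simp add: F_def hom_def)
      also have "(?r c \<otimes> g \<otimes> inv (?r (c #> g))) \<otimes> (?r (c #> g) \<otimes> h \<otimes> inv (?r (c #> g #> h)))
        = ?r c \<otimes> (g \<otimes> h) \<otimes> inv (?r (c #> (g \<otimes> h)))"
        using rep g h by (simp add: m_assoc inv_solve_left' rcoset_mult_mult[OF Q c g h])
      finally show ?thesis by (simp add: F_def)
    qed
    have "group_transfer G Q A f (g \<otimes> h) = finprod A (\<lambda>c. F g c \<otimes>\<^bsub>A\<^esub> F h (c #> g)) (rcosets Q)"
      unfolding transfer using F g h rcoset_mult_closed[OF Q _ g]
      by (intro A.finprod_cong') (auto simp: cocycle)
    also have "\<dots> = finprod A (F g) (rcosets Q) \<otimes>\<^bsub>A\<^esub> finprod A (\<lambda>c. F h (c #> g)) (rcosets Q)"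
      using F g h rcoset_mult_closed[OF Q _ g] by (intro A.finprod_multf) auto
    also have "finprod A (\<lambda>c. F h (c #> g)) (rcosets Q) = finprod A (F h) ((\<lambda>c. c #> g) ` (rcosets Q))"
      using F h rcoset_mult_bij[OF Q g] by (intro A.finprod_reindex[symmetric]) (auto simp: bij_betw_def)
    also have "(\<lambda>c. c #> g) ` (rcosets Q) = rcosets Q"
      using rcoset_mult_bij[OF Q g] by (simp add: bij_betw_def)
    finally show "group_transfer G Q A f (g \<otimes> h)
        = group_transfer G Q A f g \<otimes>\<^bsub>A\<^esub> group_transfer G Q A f h"
      by (simp add: transfer)
  qed
qed

text \<open>A central \<open>z \<in> Q\<close> fixes every coset, and each of the factors is \<open>z\<close> itself.\<close>

lemma (in group) group_transfer_central:
  assumes Q: "subgroup Q G" and A: "comm_group A" and f: "f \<in> hom (G\<lparr>carrier := Q\<rparr>) A"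
    and z: "z \<in> Q" "\<And>g. g \<in> carrier G \<Longrightarrow> z \<otimes> g = g \<otimes> z"
  shows "group_transfer G Q A f z = f z [^]\<^bsub>A\<^esub> subgroup_index G Q"
proof -
  interpret A: comm_group A by fact
  have zG: "z \<in> carrier G" using z(1) subgroup.subset[OF Q] by blast
  have fz: "f z \<in> carrier A" using f z(1) by (auto simp: hom_def)
  have "(SOME t. t \<in> c) \<otimes> z \<otimes> inv (SOME t. t \<in> c #> z) = z" if c: "c \<in> rcosets Q" for c
  proof -
    let ?t = "SOME t. t \<in> c"
    note t = rcoset_rep[OF Q c]
    have "c #> z = Q #> (?t \<otimes> z)"
      using t zG subgroup.subset[OF Q] by (metis coset_mult_assoc)
    also have "\<dots> = Q #> z #> ?t"
      using t(1) zG subgroup.subset[OF Q] z(2)[OF t(1)] by (simp add: coset_mult_assoc)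
    also have "\<dots> = c"
      using coset_join2[OF zG Q z(1)] t(2) by simp
    finally show ?thesis
      using t(1) zG z(2)[OF t(1)] by (simp add: m_assoc flip: z(2))
  qed
  then have "group_transfer G Q A f z = finprod A (\<lambda>c. f z) (rcosets Q)"
    unfolding group_transfer_def using fz by (intro A.finprod_cong') auto
  then show ?thesis
    using fz by (simp add: A.finprod_const subgroup_index_def)
qed

section \<open>Fixed points of \<open>p\<close>-groups\<close>

text \<open>The orbits have \<open>p\<close>-power length, so an orbit contributes modulo \<open>p\<close> only if it is a fixed
  point.\<close>

lemma (in group_action) p_group_fixed_points:
  assumes p: "Factorial_Ring.prime p" and ord: "order G = p ^ n" and E: "finite E"
  shows "card E mod p = card {x \<in> E. \<forall>g\<in>carrier G. \<phi> g x = x} mod p"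
proof -
  let ?F = "{x \<in> E. \<forall>g\<in>carrier G. \<phi> g x = x}"
  interpret part: partition E "orbits G E \<phi>"
    by (rule orbit_partition)
  have orbit_cong: "(\<Sum>x\<in>b. 1) mod p = (\<Sum>x\<in>b. of_bool (x \<in> ?F)) mod p" if b: "b \<in> orbits G E \<phi>" for b
  proof -
    obtain x where x: "x \<in> E" "b = orbit G \<phi> x"
      using b by (auto simp: orbits_def)
    have bE: "b \<subseteq> E" "finite b"
      using part.incl[OF b] E finite_subset by auto
    have b_eq: "b = orbit G \<phi> y" if "y \<in> b" for y
      using that bE part.disjoint_union[OF b, of "orbit G \<phi> y"] orbit_refl by (auto simp: orbits_def)
    show ?thesis
    proof (cases "\<exists>y\<in>b. y \<in> ?F")
      case True
      then obtain y where y: "y \<in> b" "y \<in> ?F" by blast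
      have "b = {y}"
        using b_eq[OF y(1)] y by (auto simp: orbit_def)
      then show ?thesis using y by simp
    next
      case False
      have "card b dvd p ^ n"
        using orbit_stabilizer_theorem[OF x(1)] x(2) ord by (metis dvd_triv_left)
      then obtain k where k: "card b = p ^ k"
        using p by (auto simp: divides_primepow_nat)
      have "card b \<noteq> 1"
      proof
        assume "card b = 1"
        then have "b = {x}"
          using orbit_refl[OF x(1)] x(2) by (auto simp: card_1_singleton_iff)
        then have "x \<in> ?F"
          using x by (auto simp: orbit_def)
        with False \<open>b = {x}\<close> show False by blast
      qed
      then have "p dvd card b" using k by (cases k) auto
      moreover have "(\<Sum>x\<in>b. of_bool (x \<in> ?F)) = (0 :: nat)"
        using False by (intro sum.neutral) auto
      ultimately show ?thesis by simp
    qed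
  qed
  have "card E mod p = (\<Sum>b\<in>orbits G E \<phi>. \<Sum>x\<in>b. 1) mod p"
    using part.disjoint_sum[OF E, of "\<lambda>_. 1 :: nat"] by simp
  also have "\<dots> = (\<Sum>b\<in>orbits G E \<phi>. \<Sum>x\<in>b. of_bool (x \<in> ?F)) mod p"
    using orbit_cong by (subst (1 2) mod_sum_eq[symmetric]) (simp cong: sum.cong)
  also have "(\<Sum>b\<in>orbits G E \<phi>. \<Sum>x\<in>b. of_bool (x \<in> ?F)) = (\<Sum>x\<in>E. of_bool (x \<in> ?F))"
    by (rule part.disjoint_sum[OF E])
  also have "\<dots> = card ?F"
    using E by (simp add: sum.If_cases of_bool_def Int_def)
  finally show ?thesis .
qed

text \<open>The preceding count for \<open>Q\<close> acting by right translation. Translating by inverses turns the right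
  action into a left one without changing the fixed points.\<close>

lemma (in group) rcosets_fixed_points:
  assumes fin: "finite (carrier G)" and p: "Factorial_Ring.prime p"
    and H: "subgroup H G" and Q: "subgroup Q G" "card Q = p ^ n"
  shows "card (rcosets H) mod p = card {c \<in> rcosets H. \<forall>q\<in>Q. c #> q = c} mod p"
proof -
  let ?Q = "G\<lparr>carrier := Q\<rparr>"
  let ?\<phi> = "\<lambda>q. \<lambda>c\<in>rcosets H. c #> inv q"
  have QG: "q \<in> carrier G" if "q \<in> Q" for q
    using that subgroup.subset[OF Q(1)] by blast
  have bij: "?\<phi> q \<in> Bij (rcosets H)" if "q \<in> Q" for q
    using rcoset_mult_bij[OF H, of "inv q"] QG[OF that] by (auto simp: Bij_def)
  have "?\<phi> \<in> hom ?Q (BijGroup (rcosets H))"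
  proof (rule homI)
    fix q r assume qr: "q \<in> carrier ?Q" "r \<in> carrier ?Q"
    have "?\<phi> (q \<otimes> r) = compose (rcosets H) (?\<phi> q) (?\<phi> r)"
      using qr QG rcoset_mult_closed[OF H]
      by (auto simp: compose_def fun_eq_iff rcoset_mult_mult[OF H] inv_mult_group)
    then show "?\<phi> (q \<otimes>\<^bsub>?Q\<^esub> r) = ?\<phi> q \<otimes>\<^bsub>BijGroup (rcosets H)\<^esub> ?\<phi> r"
      using qr bij by (simp add: BijGroup_def)
  qed (use bij in \<open>simp add: BijGroup_def\<close>)
  then interpret act: group_action ?Q "rcosets H" ?\<phi>
    using subgroup_imp_group[OF Q(1)] group_BijGroup
    by (simp add: group_action_def group_hom_def group_hom_axioms_def)
  have "finite (rcosets H)"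
    using fin rcosets_part_G[OF H] by (metis finite_UnionD)
  then have "card (rcosets H) mod p = card {c \<in> rcosets H. \<forall>q\<in>Q. ?\<phi> q c = c} mod p"
    using act.p_group_fixed_points[OF p, of n] Q(2) by (simp add: order_def)
  also have "{c \<in> rcosets H. \<forall>q\<in>Q. ?\<phi> q c = c} = {c \<in> rcosets H. \<forall>q\<in>Q. c #> q = c}"
    using subgroup.m_inv_closed[OF Q(1)] QG by (auto; metis inv_inv)
  finally show ?thesis .
qed

lemma (in group) rcoset_fixed_imp_conj:
  assumes H: "subgroup H G" and g: "g \<in> carrier G" and q: "q \<in> carrier G"
    and fixed: "H #> g #> q = H #> g"
  shows "g \<otimes> q \<otimes> inv g \<in> H"
proof -
  have "H #> g = H #> (g \<otimes> q)"
    using fixed g q subgroup.subset[OF H] by (simp add: coset_mult_assoc)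
  then have "g \<otimes> q \<in> H #> g"
    using rcos_self[OF _ H] g q by auto
  then show ?thesis
    by (rule subgroup.rcos_module_imp[OF H is_group g])
qed

text \<open>The number of cosets of \<open>P\<close> is prime to \<open>p\<close>, so \<open>Q\<close> fixes one of them; a fixed coset \<open>P g\<close> means
  that \<open>g\<close> conjugates \<open>Q\<close> into \<open>P\<close>.\<close>

lemma (in group) p_subgroup_conj_into_sylow:
  assumes fin: "finite (carrier G)" and p: "Factorial_Ring.prime p"
    and P: "subgroup P G" "\<not> p dvd subgroup_index G P"
    and Q: "subgroup Q G" "card Q = p ^ n"
  shows "\<exists>g\<in>carrier G. \<forall>q\<in>Q. g \<otimes> q \<otimes> inv g \<in> P"
proof -
  have "card (rcosets P) mod p \<noteq> 0"
    using P(2) by (simp only: subgroup_index_def dvd_eq_mod_eq_0 not_False_eq_True)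
  then have "card {c \<in> rcosets P. \<forall>q\<in>Q. c #> q = c} mod p \<noteq> 0"
    unfolding rcosets_fixed_points[OF fin p P(1) Q] .
  then have "{c \<in> rcosets P. \<forall>q\<in>Q. c #> q = c} \<noteq> {}"
    by (metis (no_types, lifting) card.empty mod_0)
  then obtain c where "c \<in> rcosets P" "\<forall>q\<in>Q. c #> q = c"
    by blast
  then obtain g where "g \<in> carrier G" "\<forall>q\<in>Q. P #> g #> q = P #> g"
    by (auto simp: RCOSETS_def)
  then show ?thesis
    using rcoset_fixed_imp_conj[OF P(1)] subgroup.subset[OF Q(1)] by blast
qed

section \<open>Abelian quotients\<close>

lemma (in group) prime_order_imp_comm_group:
  assumes p: "Factorial_Ring.prime p" and ord: "order G = p"
  shows "comm_group G"
proof -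
  have fin: "finite (carrier G)"
    using ord prime_gt_0_nat[OF p] by (simp flip: order_gt_0_iff_finite)
  have "carrier G \<noteq> {\<one>}"
    using ord p by (auto simp: order_def)
  then obtain x where x: "x \<in> carrier G" "x \<noteq> \<one>" by blast
  have sub: "subgroup (generate G {x}) G"
    using x by (intro generate_is_subgroup) auto
  then have "card (generate G {x}) dvd p"
    using lagrange[OF sub] ord by (metis dvd_triv_right)
  moreover have "{\<one>, x} \<subseteq> generate G {x}"
    by (simp add: generate.one generate.incl)
  then have "card (generate G {x}) \<noteq> 1"
    using x(2) by (auto simp: card_1_singleton_iff)
  ultimately have "card (generate G {x}) = card (carrier G)"
    using p ord by (auto simp: order_def prime_nat_iff)
  then have "generate G {x} = carrier G"
    using sub fin by (simp add: card_subset_eq subgroup.subset)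
  then have "carrier G = range (\<lambda>n::int. x [^] n)"
    using generate_pow[OF x(1)] by (simp add: full_SetCompr_eq)
  then show ?thesis
    using x(1) cyclic_group cyclic_imp_abelian_group by blast
qed

text \<open>A subgroup \<open>M\<close> of index \<open>p\<close> exists by Sylow's theorem. Acting on its \<open>p\<close> cosets, \<open>M\<close> fixes the
  coset \<open>M\<close>, so the number of fixed points, a positive multiple of \<open>p\<close>, is \<open>p\<close>. Hence \<open>M\<close> is
  normal, with abelian quotient.\<close>

lemma (in group) p_group_not_perfect:
  assumes p: "Factorial_Ring.prime p" and ord: "order G = p ^ Suc n"
  shows "derived G (carrier G) \<noteq> carrier G"
proof -
  have fin: "finite (carrier G)"
    using ord prime_gt_0_nat[OF p] by (simp flip: order_gt_0_iff_finite)
  obtain M where M: "subgroup M G" "card M = p ^ n"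
    using sylow_thm[OF p is_group _ fin, of n p] ord by (auto simp: mult.commute)
  have index: "card (rcosets M) = p"
    using lagrange[OF M(1)] M(2) ord prime_gt_0_nat[OF p] by simp
  let ?F = "{c \<in> rcosets M. \<forall>q\<in>M. c #> q = c}"
  have finR: "finite (rcosets M)"
    using index prime_gt_0_nat[OF p] by (simp add: card_ge_0_finite)
  have "M \<in> ?F"
    using subgroup.subset[OF M(1)] coset_join2[OF _ M(1)] subgroup.subgroup_in_rcosets[OF M(1) is_group]
    by auto
  moreover have "p dvd card ?F"
    using rcosets_fixed_points[OF fin p M(1) M] index by (simp add: dvd_eq_mod_eq_0)
  ultimately have "card ?F = card (rcosets M)"
    using finR index card_mono[OF finR, of ?F] card_gt_0_iff[of ?F] dvd_imp_le[of p "card ?F"] by force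
  then have F: "?F = rcosets M"
    using finR by (intro card_subset_eq) auto
  have conj: "g \<otimes> q \<otimes> inv g \<in> M" if "g \<in> carrier G" "q \<in> M" for g q
    using that F rcosetsI[OF subgroup.subset[OF M(1)], of g] subgroup.subset[OF M(1)]
    by (intro rcoset_fixed_imp_conj[OF M(1)]) blast+
  have normal: "M \<lhd> G"
    using M(1) conj by (rule normal_invI)
  have "comm_group (G Mod M)"
    using index by (intro group.prime_order_imp_comm_group[OF normal.factorgroup_is_group[OF normal] p])
      (simp add: order_def FactGroup_def)
  then have "derived G (carrier G) \<subseteq> M"
    by (rule derived_minimal[OF normal])
  moreover have "card M < card (carrier G)"
    using M(2) ord prime_gt_1_nat[OF p] by (simp add: order_def)
  ultimately show ?thesis
    using fin M(1) by (metis card_mono finite_subset leD subgroup.subset)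
qed

lemma (in group) coprime_powers_mem:
  assumes S: "subgroup S G" and x: "x \<in> carrier G" "x [^] (a::nat) \<in> S" "x [^] (b::nat) \<in> S"
    and ab: "coprime a b"
  shows "x \<in> S"
proof -
  obtain u v where uv: "u * int a + v * int b = 1"
    using ab bezout_int[of "int a" "int b"] by (metis coprime_imp_gcd_eq_1 coprime_int_iff)
  have "(x [^] a) [^] u \<otimes> (x [^] b) [^] v = x [^] (int a * u + int b * v)"
    using x(1) by (simp add: int_pow_mult int_pow_pow flip: int_pow_int)
  then have "x = (x [^] a) [^] u \<otimes> (x [^] b) [^] v"
    using uv x(1) by (simp add: mult.commute)
  moreover have "(x [^] a) [^] u \<otimes> (x [^] b) [^] v \<in> S"
    using S x by (intro subgroup.m_closed subgroup_int_pow_closed)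
  ultimately show ?thesis by simp
qed

lemma (in group) pow_FactGroup:
  assumes N: "N \<lhd> G" and x: "x \<in> carrier G"
  shows "(N #> x) [^]\<^bsub>G Mod N\<^esub> (n::nat) = N #> (x [^] n)"
proof -
  interpret h: group_hom G "G Mod N" "\<lambda>x. N #> x"
    using normal.r_coset_hom_Mod[OF N] normal.factorgroup_is_group[OF N]
    by (simp add: group_hom_def group_hom_axioms_def)
  show ?thesis using h.hom_nat_pow[OF x] by simp
qed

lemma (in group) pow_subgroup_index_mem:
  assumes N: "N \<lhd> G" and x: "x \<in> carrier G"
  shows "x [^] subgroup_index G N \<in> N"
proof -
  interpret F: group "G Mod N" by (rule normal.factorgroup_is_group[OF N])
  have "(N #> x) [^]\<^bsub>G Mod N\<^esub> order (G Mod N) = \<one>\<^bsub>G Mod N\<^esub>"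
    using x N by (intro F.pow_order_eq_1) (auto simp: FactGroup_def RCOSETS_def)
  then have "N #> x [^] subgroup_index G N = N"
    using pow_FactGroup[OF N x] by (simp add: FactGroup_def order_def subgroup_index_def)
  then show ?thesis
    using coset_join1 x N normal_imp_subgroup by blast
qed

text \<open>The quotient by \<open>N\<close> is a nontrivial \<open>p\<close>-group \<open>H\<close>. If \<open>p\<close> did not divide \<open>m = |G : G'|\<close>, every
  \<open>y \<in> H\<close> would satisfy \<open>y\<^sup>m \<in> H'\<close> as well as \<open>y\<^bsup>|H|\<^esup> = 1\<close> with coprime exponents, which makes \<open>H\<close>
  perfect.\<close>

lemma (in group) p_quotient_imp_p_dvd_abelianization:
  assumes p: "Factorial_Ring.prime p" and N: "N \<lhd> G" "subgroup_index G N = p ^ n" "N \<noteq> carrier G"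
  shows "p dvd subgroup_index G (derived G (carrier G))"
proof (rule ccontr)
  assume not: "\<not> p dvd subgroup_index G (derived G (carrier G))"
  let ?m = "subgroup_index G (derived G (carrier G))" and ?H = "G Mod N"
  interpret H: group ?H by (rule normal.factorgroup_is_group[OF N(1)])
  interpret h: group_hom G ?H "\<lambda>x. N #> x"
    using normal.r_coset_hom_Mod[OF N(1)] by unfold_locales
  have surj: "(\<lambda>x. N #> x) ` carrier G = carrier ?H"
    by (auto simp: FactGroup_def RCOSETS_def)
  have ordH: "order ?H = p ^ n"
    using N(2) by (simp add: FactGroup_def order_def subgroup_index_def)
  have "n \<noteq> 0"
  proof
    assume "n = 0"
    then have card: "card (rcosets N) = 1" using N(2) by (simp add: subgroup_index_def)
    have "x \<in> N" if x: "x \<in> carrier G" for x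
    proof -
      note NG = normal_imp_subgroup[OF N(1)]
      have "N #> x \<in> rcosets N" "N \<in> rcosets N"
        using rcosetsI[OF subgroup.subset[OF NG] x] subgroup.subgroup_in_rcosets[OF NG is_group] by auto
      then have "N #> x = N"
        using card by (auto simp: card_1_singleton_iff)
      then show ?thesis
        by (rule coset_join1[OF _ x NG])
    qed
    then show False
      using N(1,3) normal_imp_subgroup subgroup.subset by blast
  qed
  then obtain k where k: "n = Suc k" by (cases n) auto
  have "carrier ?H \<subseteq> derived ?H (carrier ?H)"
  proof
    fix y assume y: "y \<in> carrier ?H"
    then obtain x where x: "x \<in> carrier G" "y = N #> x" using surj by blast
    have D: "subgroup (derived ?H (carrier ?H)) ?H"
      by (rule H.derived_is_subgroup) simp
    have "y [^]\<^bsub>?H\<^esub> ?m = N #> (x [^] ?m)"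
      using pow_FactGroup[OF N(1) x(1)] x(2) by simp
    also have "\<dots> \<in> (\<lambda>x. N #> x) ` derived G (carrier G)"
      using pow_subgroup_index_mem[OF derived_self_is_normal x(1)] by blast
    also have "(\<lambda>x. N #> x) ` derived G (carrier G) = derived ?H (carrier ?H)"
      using h.derived_img[of "carrier G"] surj by simp
    finally have "y [^]\<^bsub>?H\<^esub> ?m \<in> derived ?H (carrier ?H)" .
    moreover have "y [^]\<^bsub>?H\<^esub> (p ^ n) \<in> derived ?H (carrier ?H)"
      using H.pow_order_eq_1[OF y] ordH subgroup.one_closed[OF D] by simp
    moreover have "coprime ?m (p ^ n)"
      using not p by (simp add: prime_imp_coprime coprime_commute)
    ultimately show "y \<in> derived ?H (carrier ?H)"
      by (rule H.coprime_powers_mem[OF D y])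
  qed
  moreover have "derived ?H (carrier ?H) \<subseteq> carrier ?H"
    by (rule H.derived_in_carrier) simp
  ultimately show False
    using H.p_group_not_perfect[OF p, of k] ordH k by simp
qed

text \<open>Suppose \<open>p\<close> does not divide \<open>m = |G : G'|\<close>. The transfer to \<open>Q/Q'\<close> kills \<open>z\<^sup>m \<in> G'\<close> and maps it
  to the class of \<open>z\<^bsup>m |G : Q|\<^esup>\<close>. So \<open>Q'\<close> contains this power of \<open>z\<close> and also the trivial power with
  exponent \<open>p\<^sup>k\<close>, hence \<open>z\<close> itself.\<close>

lemma (in group) central_p_element_imp_p_dvd_abelianization:
  assumes p: "Factorial_Ring.prime p" and Q: "subgroup Q G" "\<not> p dvd subgroup_index G Q"
    and z: "z \<in> Q" "\<And>g. g \<in> carrier G \<Longrightarrow> z \<otimes> g = g \<otimes> z" "z [^] (p ^ k) = \<one>"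
    and notin: "z \<notin> derived G Q"
  shows "p dvd subgroup_index G (derived G (carrier G))"
proof (rule ccontr)
  assume not: "\<not> p dvd subgroup_index G (derived G (carrier G))"
  let ?m = "subgroup_index G (derived G (carrier G))" and ?i = "subgroup_index G Q"
  let ?Q = "G\<lparr>carrier := Q\<rparr>"
  let ?A = "?Q Mod derived G Q"
  let ?f = "\<lambda>x. derived G Q #>\<^bsub>?Q\<^esub> x"
  let ?V = "group_transfer G Q ?A ?f"
  interpret A: comm_group ?A by (rule derived_quot_of_subgroup_is_comm_group[OF Q(1)])
  interpret Q: group ?Q by (rule subgroup_imp_group[OF Q(1)])
  have D: "derived G Q \<lhd> ?Q" by (rule derived_subgroup_is_normal[OF Q(1)])
  have zG: "z \<in> carrier G" using z(1) subgroup.subset[OF Q(1)] by blast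
  have zpow: "z [^] (n::nat) \<in> Q" for n
    using Q.nat_pow_closed[of z n] z(1) by (simp flip: nat_pow_consistent)
  have f: "?f \<in> hom ?Q ?A" by (rule normal.r_coset_hom_Mod[OF D])
  have fz: "?f z \<in> carrier ?A" using f z(1) by (auto simp: hom_def)
  interpret V: group_hom G ?A ?V
    using group_transfer_hom[OF Q(1) A.comm_group_axioms f] by unfold_locales
  have "?V ` derived G (carrier G) = {\<one>\<^bsub>?A\<^esub>}"
    using V.derived_img[of "carrier G"] A.derived_eq_singleton[of "?V ` carrier G"] V.hom_closed by auto
  moreover have "z [^] ?m \<in> derived G (carrier G)"
    by (rule pow_subgroup_index_mem[OF derived_self_is_normal zG])
  ultimately have "\<one>\<^bsub>?A\<^esub> = ?V (z [^] ?m)" by blast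
  also have "\<dots> = (?f z [^]\<^bsub>?A\<^esub> ?i) [^]\<^bsub>?A\<^esub> ?m"
    using group_transfer_central[OF Q(1) A.comm_group_axioms f z(1,2)] V.hom_nat_pow[OF zG] by simp
  also have "\<dots> = ?f (z [^] (?i * ?m))"
    unfolding A.nat_pow_pow[OF fz] using Q.pow_FactGroup[OF D, of z] z(1) by (simp flip: nat_pow_consistent)
  finally have "?f (z [^] (?i * ?m)) = derived G Q"
    by (simp add: FactGroup_def)
  then have "z [^] (?i * ?m) \<in> derived G Q"
    using Q.coset_join1[OF _ _ normal_imp_subgroup[OF D]] zpow by simp
  moreover have DG: "subgroup (derived G Q) G"
    by (rule derived_is_subgroup[OF subgroup.subset[OF Q(1)]])
  then have "z [^] (p ^ k) \<in> derived G Q"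
    using z(3) subgroup.one_closed by fastforce
  moreover have "coprime (?i * ?m) (p ^ k)"
    using not Q(2) p by (metis coprime_commute coprime_mult_right_iff coprime_power_right_iff prime_imp_coprime)
  ultimately have "z \<in> derived G Q"
    by (intro coprime_powers_mem[OF DG zG])
  with notin show False ..
qed

section \<open>Metacyclic \<open>p\<close>-groups\<close>

lemma (in group) conjugation_group_hom:
  assumes "g \<in> carrier G"
  shows "group_hom G G (\<lambda>x. g \<otimes> x \<otimes> inv g)"
proof (unfold_locales, rule homI)
  fix x y assume xy: "x \<in> carrier G" "y \<in> carrier G"
  have "g \<otimes> x \<otimes> inv g \<otimes> (g \<otimes> y \<otimes> inv g) = g \<otimes> x \<otimes> (inv g \<otimes> g) \<otimes> y \<otimes> inv g"
    using assms xy by (simp only: m_assoc m_closed inv_closed)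
  then show "g \<otimes> (x \<otimes> y) \<otimes> inv g = g \<otimes> x \<otimes> inv g \<otimes> (g \<otimes> y \<otimes> inv g)"
    using assms xy by (simp add: m_assoc)
qed (use assms in simp)

lemma (in group) finite_cyclic_nat_powers:
  assumes "finite (carrier G)" "cyclic_group G"
  obtains a where "a \<in> carrier G" "carrier G = {a [^] k | k. k \<in> (UNIV :: nat set)}"
proof -
  obtain a where a: "a \<in> carrier G" "carrier G = range (\<lambda>n::int. a [^] n)"
    using assms(2) cyclic_group by blast
  then have "carrier G = generate G {a}"
    using generate_pow[OF a(1)] by (simp add: full_SetCompr_eq)
  then show ?thesis
    using that[OF a(1)] generate_pow_on_finite_carrier[OF assms(1) a(1)] by simp
qed

lemma (in group) central_times_power_imp_comm_group:
  assumes a: "a \<in> carrier G" "\<And>g. g \<in> carrier G \<Longrightarrow> a \<otimes> g = g \<otimes> a" and b: "b \<in> carrier G"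
    and gen: "\<And>x. x \<in> carrier G \<Longrightarrow> \<exists>(i::nat) (j::nat). x = a [^] i \<otimes> b [^] j"
  shows "comm_group G"
proof (rule group_comm_groupI)
  fix x y assume "x \<in> carrier G" "y \<in> carrier G"
  then obtain i j k l :: nat where x: "x = a [^] i \<otimes> b [^] j" and y: "y = a [^] k \<otimes> b [^] l"
    using gen by meson
  have central: "a [^] n \<otimes> g = g \<otimes> a [^] n" if "g \<in> carrier G" for g and n :: nat
    using group_commutes_pow[OF a(2)[OF that] a(1) that] .
  have swap: "a [^] m \<otimes> b [^] r \<otimes> (a [^] n \<otimes> b [^] s) = a [^] (m + n) \<otimes> b [^] (r + s)" for m n r s :: nat
  proof -
    have "a [^] m \<otimes> b [^] r \<otimes> (a [^] n \<otimes> b [^] s) = a [^] m \<otimes> (b [^] r \<otimes> a [^] n) \<otimes> b [^] s"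
      using a(1) b by (simp add: m_assoc)
    also have "\<dots> = a [^] m \<otimes> (a [^] n \<otimes> b [^] r) \<otimes> b [^] s"
      using central[of "b [^] r" n] b by simp
    also have "\<dots> = (a [^] m \<otimes> a [^] n) \<otimes> (b [^] r \<otimes> b [^] s)"
      using a(1) b by (simp add: m_assoc del: nat_pow_mult)
    also have "\<dots> = a [^] (m + n) \<otimes> b [^] (r + s)"
      using a(1) b by (simp add: nat_pow_mult)
    finally show ?thesis .
  qed
  show "x \<otimes> y = y \<otimes> x"
    unfolding x y swap by (simp add: add.commute)
qed

lemma prime_power_cong_one:
  fixes r :: nat
  assumes p: "Factorial_Ring.prime p" and r: "[r ^ (p ^ s) = 1] (mod p)"
  shows "[r = 1] (mod p)"
proof -
  have fermat: "[r ^ p = r] (mod p)"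
  proof (cases "p dvd r")
    case True
    then show ?thesis
      using prime_gt_0_nat[OF p] by (simp add: cong_def dvd_power_iff_le mod_eq_0_iff_dvd dvd_trans[OF _ dvd_power])
  next
    case False
    have "[r ^ (p - 1) * r = 1 * r] (mod p)"
      using fermat_theorem[OF p False] by (rule cong_mult) simp
    then show ?thesis
      using prime_gt_0_nat[OF p] by (simp flip: power_Suc2)
  qed
  have "[r ^ (p ^ s) = r] (mod p)"
  proof (induction s)
    case (Suc s)
    then have "[(r ^ (p ^ s)) ^ p = r ^ p] (mod p)"
      by (rule cong_pow)
    then show ?case
      using fermat by (simp add: power_mult[symmetric] mult.commute) (metis cong_trans)
  qed simp
  then show ?thesis
    using r cong_sym cong_trans by blast
qed

text \<open>Iterating the conjugation gives \<open>a = a\<^bsup>R\<^esup>\<close> for \<open>R = r\<^bsup>p^s\<^esup>\<close>, so \<open>R \<equiv> 1\<close> modulo the order of \<open>a\<close>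
  and in particular modulo \<open>p\<close>; Fermat's theorem identifies \<open>R\<close> with \<open>r\<close> modulo \<open>p\<close>.\<close>

lemma (in group) pow_conj_fixed_imp_cong:
  assumes p: "Factorial_Ring.prime p" and a: "a \<in> carrier G" "ord a = p ^ Suc m"
    and g: "g \<in> carrier G" "g [^] (p ^ s) = \<one>" and conj: "g \<otimes> a \<otimes> inv g = a [^] (r::nat)"
  shows "[r = 1] (mod p)"
proof -
  interpret c: group_hom G G "\<lambda>x. g \<otimes> x \<otimes> inv g" by (rule conjugation_group_hom[OF g(1)])
  have "g [^] k \<otimes> a \<otimes> inv (g [^] k) = a [^] (r ^ k)" for k :: nat
  proof (induction k)
    case (Suc k)
    have gk: "g [^] Suc k = g \<otimes> g [^] k"
      by (rule nat_pow_Suc2[OF g(1)])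
    have "g [^] Suc k \<otimes> a \<otimes> inv (g [^] Suc k) = g \<otimes> (g [^] k \<otimes> a \<otimes> inv (g [^] k)) \<otimes> inv g"
      unfolding gk using g(1) a(1) by (simp add: inv_mult_group m_assoc)
    also have "\<dots> = (g \<otimes> a \<otimes> inv g) [^] (r ^ k)"
      unfolding Suc.IH using c.hom_nat_pow[OF a(1)] by simp
    also have "\<dots> = a [^] (r ^ Suc k)"
      unfolding conj using a(1) by (simp add: nat_pow_pow)
    finally show ?case .
  qed (use a(1) in simp)
  from this[of "p ^ s"] have "a [^] (r ^ (p ^ s)) = a [^] (1::nat)"
    using g a(1) by simp
  then have "a [^] int (r ^ (p ^ s)) = a [^] int 1"
    unfolding int_pow_int .
  then have "int (p ^ Suc m) dvd int 1 - int (r ^ (p ^ s))"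
    using int_pow_eq[OF a(1)] a(2) by auto
  then have "int p dvd int 1 - int (r ^ (p ^ s))"
    by (rule dvd_trans[rotated]) simp
  then have "[int 1 = int (r ^ (p ^ s))] (mod int p)"
    by (simp only: cong_iff_dvd_diff)
  then have "[r ^ (p ^ s) = 1] (mod p)"
    by (simp only: cong_int_iff cong_sym_eq)
  then show ?thesis by (rule prime_power_cong_one[OF p])
qed

text \<open>Let \<open>N\<close> be generated by \<open>a\<close> of order \<open>p\<^sup>m\<close>, let \<open>e = p\<^bsup>m-1\<^esup>\<close> and let \<open>M\<close> be the subgroup of all
  \<open>y \<in> N\<close> with \<open>y\<^sup>e = 1\<close>. Every \<open>g\<close> maps \<open>a\<close> to \<open>a\<^sup>r\<close> with \<open>r \<equiv> 1\<close> modulo \<open>p\<close>, so \<open>a\<^bsup>r-1\<^esup> \<in> M\<close> and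
  \<open>a\<close> is central modulo \<open>M\<close>. Then \<open>G/M\<close> is generated by a central element and one more, hence abelian,
  and \<open>M\<close> contains \<open>G'\<close>, while \<open>a\<^sup>e \<noteq> 1\<close>. If \<open>N\<close> is trivial (\<open>m = 0\<close>), truncated subtraction gives
  \<open>e = 1\<close> and any nontrivial element takes the place of \<open>a\<close>.\<close>

lemma (in group) metacyclic_p_group_exponent_derived:
  assumes p: "Factorial_Ring.prime p" and ord: "order G = p ^ Suc n" and meta: "metacyclic G"
  shows "\<exists>e::nat. (\<forall>y\<in>derived G (carrier G). y [^] e = \<one>) \<and> (\<exists>x\<in>carrier G. x [^] e \<noteq> \<one>)"
proof -
  have fin: "finite (carrier G)"
    using ord prime_gt_0_nat[OF p] by (simp flip: order_gt_0_iff_finite)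
  obtain N where N: "N \<lhd> G" "cyclic_group (G\<lparr>carrier := N\<rparr>)" "cyclic_group (G Mod N)"
    using meta by (auto simp: metacyclic_def)
  note NG = normal_imp_subgroup[OF N(1)]
  have NC: "x \<in> carrier G" if "x \<in> N" for x using that subgroup.subset[OF NG] by blast
  interpret NN: group "G\<lparr>carrier := N\<rparr>" by (rule subgroup_imp_group[OF NG])
  interpret F: group "G Mod N" by (rule normal.factorgroup_is_group[OF N(1)])
  obtain a where a: "a \<in> N" "N = {a [^] k | k. k \<in> (UNIV :: nat set)}"
    using NN.finite_cyclic_nat_powers[OF _ N(2)] finite_subset[OF subgroup.subset[OF NG] fin]
    by (auto simp flip: nat_pow_consistent)
  note aG = NC[OF a(1)]
  have "finite (carrier (G Mod N))"
    using fin rcosets_part_G[OF NG] by (auto simp: FactGroup_def intro: finite_UnionD)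
  then obtain B where B: "B \<in> carrier (G Mod N)"
      "carrier (G Mod N) = {B [^]\<^bsub>G Mod N\<^esub> k | k. k \<in> (UNIV :: nat set)}"
    using F.finite_cyclic_nat_powers[OF _ N(3)] by blast
  then obtain b where b: "b \<in> carrier G" "B = N #> b"
    by (auto simp: FactGroup_def RCOSETS_def)
  have gen: "\<exists>(i::nat) (j::nat). x = a [^] i \<otimes> b [^] j" if x: "x \<in> carrier G" for x
  proof -
    have "N #> x \<in> carrier (G Mod N)"
      using x by (auto simp: FactGroup_def RCOSETS_def)
    then obtain j :: nat where "N #> x = N #> (b [^] j)"
      using B(2) pow_FactGroup[OF N(1) b(1)] b(2) by auto
    then have "x \<in> N #> (b [^] j)"
      using rcos_self[OF x NG] by simp
    then show ?thesis
      using a(2) by (auto simp: r_coset_def)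
  qed
  obtain m where m: "ord a = p ^ m"
    using ord_dvd_group_order[OF aG] ord p by (auto simp: divides_primepow_nat simp del: power_Suc)
  define e where "e = p ^ (m - 1)"
  define M where "M = {y \<in> N. y [^] e = \<one>}"
  have N_comm: "y \<otimes> z = z \<otimes> y" if "y \<in> N" "z \<in> N" for y z
    using that a(2) aG by (auto simp: nat_pow_mult add.commute)
  have M_sub: "subgroup M G"
  proof (rule subgroupI)
    show "M \<noteq> {}" using subgroup.one_closed[OF NG] by (auto simp: M_def)
    show "inv y \<in> M" if "y \<in> M" for y
      using that NC subgroup.m_inv_closed[OF NG] by (auto simp: M_def nat_pow_inv)
    show "y \<otimes> z \<in> M" if "y \<in> M" "z \<in> M" for y z
      using that NC subgroup.m_closed[OF NG] pow_mult_distrib[OF N_comm, of y z e] by (auto simp: M_def)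
  qed (use NC in \<open>auto simp: M_def\<close>)
  have M: "M \<lhd> G"
  proof (rule normal_invI[OF M_sub])
    fix g y assume g: "g \<in> carrier G" and y: "y \<in> M"
    interpret c: group_hom G G "\<lambda>x. g \<otimes> x \<otimes> inv g" by (rule conjugation_group_hom[OF g])
    show "g \<otimes> y \<otimes> inv g \<in> M"
      using y g c.hom_nat_pow[of y e] NC normal.inv_op_closed2[OF N(1) g, of y] by (auto simp: M_def)
  qed
  have conj_a: "\<exists>y\<in>M. g \<otimes> a = y \<otimes> (a \<otimes> g)" if g: "g \<in> carrier G" for g
  proof (cases m)
    case 0
    then have "a = \<one>" using m aG ord_eq_1 by simp
    then show ?thesis using g subgroup.one_closed[OF M_sub] by (intro bexI[of _ \<one>]) auto
  next
    case (Suc m')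
    have "g \<otimes> a \<otimes> inv g \<in> N" by (rule normal.inv_op_closed2[OF N(1) g a(1)])
    then obtain r :: nat where r: "g \<otimes> a \<otimes> inv g = a [^] r" using a(2) by blast
    have "[r = 1] (mod p)"
      using m Suc pow_order_eq_1[OF g] ord
      by (intro pow_conj_fixed_imp_cong[OF p aG _ g _ r, of m' "Suc n"]) auto
    then have r_mod: "r mod p = 1"
      using prime_gt_1_nat[OF p] by (simp add: cong_def)
    then have r1: "r \<noteq> 0"
      by (intro notI) simp
    then have "p dvd r - 1"
      using r_mod dvd_minus_mod[of p r] by simp
    then have "p ^ m dvd (r - 1) * e"
      by (auto simp: e_def Suc intro: mult_dvd_mono)
    then have "(a [^] (r - 1)) [^] e = \<one>"
      using aG m by (simp add: nat_pow_pow pow_eq_id)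
    then have "a [^] (r - 1) \<in> M"
      using a(2) by (auto simp: M_def)
    moreover have "g \<otimes> a = a [^] (r - 1) \<otimes> (a \<otimes> g)"
    proof -
      have "a [^] r = a [^] (r - 1) \<otimes> a"
        using r1 by (cases r) auto
      moreover have "g \<otimes> a = a [^] r \<otimes> g"
        using r g aG by (metis inv_solve_right m_closed nat_pow_closed)
      ultimately show ?thesis using g aG by (simp add: m_assoc)
    qed
    ultimately show ?thesis by blast
  qed
  interpret Q: group "G Mod M" by (rule normal.factorgroup_is_group[OF M])
  have Q_mult: "(M #> x) \<otimes>\<^bsub>G Mod M\<^esub> (M #> y) = M #> (x \<otimes> y)" if "x \<in> carrier G" "y \<in> carrier G" for x y
    using normal.rcos_sum[OF M that] by (simp add: FactGroup_def)
  have Q_carrier: "carrier (G Mod M) = (\<lambda>x. M #> x) ` carrier G"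
    by (auto simp: FactGroup_def RCOSETS_def)
  have "comm_group (G Mod M)"
  proof (rule Q.central_times_power_imp_comm_group[of "M #> a" "M #> b"])
    fix Y assume "Y \<in> carrier (G Mod M)"
    then obtain x where x: "x \<in> carrier G" "Y = M #> x" unfolding Q_carrier by blast
    obtain y where y: "y \<in> M" "x \<otimes> a = y \<otimes> (a \<otimes> x)" using conj_a[OF x(1)] by blast
    then have "M #> (x \<otimes> a) = M #> y #> (a \<otimes> x)"
      using x(1) aG NC subgroup.subset[OF M_sub] by (auto simp: coset_mult_assoc M_def)
    also have "\<dots> = M #> (a \<otimes> x)"
      using coset_join2[OF _ M_sub y(1)] y(1) subgroup.subset[OF M_sub] by auto
    finally show "(M #> a) \<otimes>\<^bsub>G Mod M\<^esub> Y = Y \<otimes>\<^bsub>G Mod M\<^esub> (M #> a)"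
      using x aG by (simp only: Q_mult)
    obtain i j :: nat where "x = a [^] i \<otimes> b [^] j" using gen[OF x(1)] by blast
    then have "Y = (M #> a) [^]\<^bsub>G Mod M\<^esub> i \<otimes>\<^bsub>G Mod M\<^esub> (M #> b) [^]\<^bsub>G Mod M\<^esub> j"
      using x(2) aG b(1) by (simp only: pow_FactGroup[OF M] Q_mult nat_pow_closed)
    then show "\<exists>i j. Y = (M #> a) [^]\<^bsub>G Mod M\<^esub> (i::nat) \<otimes>\<^bsub>G Mod M\<^esub> (M #> b) [^]\<^bsub>G Mod M\<^esub> (j::nat)"
      by blast
  qed (use aG b(1) Q_carrier in auto)
  then have "derived G (carrier G) \<subseteq> M"
    by (rule derived_minimal[OF M])
  moreover have "\<exists>x\<in>carrier G. x [^] e \<noteq> \<one>"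
  proof (cases m)
    case 0
    have "1 < card (carrier G)"
      unfolding ord[unfolded order_def] using prime_gt_1_nat[OF p] by (rule one_less_power) simp
    then have "\<not> carrier G \<subseteq> {\<one>}"
      using card_mono[of "{\<one>}" "carrier G"] by auto
    then show ?thesis using 0 by (auto simp: e_def)
  next
    case (Suc m')
    have "\<not> p ^ Suc m' dvd p ^ m'"
      using prime_gt_1_nat[OF p] by (simp add: power_dvd_imp_le)
    then show ?thesis
      using aG m Suc by (intro bexI[of _ a]) (auto simp: e_def pow_eq_id)
  qed
  ultimately show ?thesis by (auto simp: M_def)
qed

section \<open>Centralizers\<close>

lemma (in group) elt_centralizer_subgroup:
  assumes x: "x \<in> carrier G"
  shows "subgroup (elt_centralizer G x) G"
proof (rule subgroupI)
  show "elt_centralizer G x \<noteq> {}" using x by (auto simp: elt_centralizer_def)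
  fix y assume y: "y \<in> elt_centralizer G x"
  then show "inv y \<in> elt_centralizer G x"
    using x by (auto simp: elt_centralizer_def) (metis inv_closed inv_solve_left inv_solve_right m_assoc m_closed)
  fix z assume z: "z \<in> elt_centralizer G x"
  with y show "y \<otimes> z \<in> elt_centralizer G x"
    using x by (auto simp: elt_centralizer_def) (metis m_assoc)
qed (auto simp: elt_centralizer_def)

text \<open>The element \<open>x\<close> is central in its centralizer, where the transfer argument applies.\<close>

lemma (in group) centralizer_p_elementsI:
  assumes p: "Factorial_Ring.prime p" and x: "x \<in> carrier G" "x [^] (p ^ k) = \<one>"
    and Q: "subgroup Q (G\<lparr>carrier := elt_centralizer G x\<rparr>)"
      "\<not> p dvd subgroup_index (G\<lparr>carrier := elt_centralizer G x\<rparr>) Q"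
    and xQ: "x \<in> Q" "x \<notin> derived G Q"
  shows "x \<in> centralizer_p_elements p G"
proof -
  let ?C = "elt_centralizer G x"
  let ?H = "G\<lparr>carrier := ?C\<rparr>"
  note C = elt_centralizer_subgroup[OF x(1)]
  interpret H: group ?H by (rule subgroup_imp_group[OF C])
  have QC: "Q \<subseteq> ?C" using subgroup.subset[OF Q(1)] by simp
  have "p dvd subgroup_index ?H (derived ?H (carrier ?H))"
  proof (rule H.central_p_element_imp_p_dvd_abelianization[OF p Q xQ(1)])
    show "x \<otimes>\<^bsub>?H\<^esub> g = g \<otimes>\<^bsub>?H\<^esub> x" if "g \<in> carrier ?H" for g
      using that by (simp add: elt_centralizer_def)
    show "x [^]\<^bsub>?H\<^esub> (p ^ k) = \<one>\<^bsub>?H\<^esub>"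
      using x(2) by (simp flip: nat_pow_consistent)
    show "x \<notin> derived ?H Q"
      using xQ(2) derived_consistent[OF QC C] by simp
  qed
  then show ?thesis
    using x(1) derived_consistent[OF subset_refl C] by (simp add: centralizer_p_elements_def)
qed

text \<open>Take a Sylow subgroup \<open>Q\<close> of \<open>C = C\<^sub>G(x)\<close>. It contains the central \<open>p\<close>-element \<open>x\<close>, since the
  \<open>p\<close>-group generated by \<open>x\<close> is conjugate into \<open>Q\<close> inside \<open>C\<close>. Moreover \<open>g Q g\<^sup>-\<^sup>1 \<le> P\<close> for some
  \<open>g \<in> G\<close>, so \<open>x \<in> Q'\<close> would give \<open>g x g\<^sup>-\<^sup>1 \<in> P'\<close>.\<close>

lemma (in group) conj_avoids_derived_sylow_imp_centralizer_p_element: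
  assumes fin: "finite (carrier G)" and p: "Factorial_Ring.prime p"
    and P: "subgroup P G" "\<not> p dvd subgroup_index G P"
    and x: "x \<in> carrier G" "x [^] (p ^ k) = \<one>"
    and conj: "\<And>g. g \<in> carrier G \<Longrightarrow> g \<otimes> x \<otimes> inv g \<notin> derived G P"
  shows "x \<in> centralizer_p_elements p G"
proof -
  let ?C = "elt_centralizer G x"
  let ?H = "G\<lparr>carrier := ?C\<rparr>"
  note C = elt_centralizer_subgroup[OF x(1)]
  interpret H: group ?H by (rule subgroup_imp_group[OF C])
  have finH: "finite (carrier ?H)"
    using fin subgroup.subset[OF C] finite_subset by auto
  have xC: "x \<in> ?C" using x(1) by (simp add: elt_centralizer_def)
  have ordH: "order ?H \<noteq> 0" using finH H.order_gt_0_iff_finite by auto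
  obtain m where m: "order ?H = p ^ multiplicity p (order ?H) * m" "\<not> p dvd m"
    using multiplicity_decompose'[OF ordH, of p] p by (metis not_prime_unit)
  obtain Q where Q: "subgroup Q ?H" "card Q = p ^ multiplicity p (order ?H)"
    using sylow_thm[OF p H.is_group m(1) finH] by blast
  have index: "subgroup_index ?H Q = m"
  proof -
    have "subgroup_index ?H Q * card Q = m * card Q"
      using H.lagrange[OF Q(1)] Q(2) m(1) by (metis mult.commute subgroup_index_def)
    then show ?thesis
      using Q(2) prime_gt_0_nat[OF p] by simp
  qed
  have QC: "Q \<subseteq> ?C" using subgroup.subset[OF Q(1)] by simp
  have QG: "subgroup Q G" by (rule incl_subgroup[OF C Q(1)])
  have "x \<in> Q"
  proof -
    have gen: "subgroup (generate ?H {x}) ?H"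
      using xC by (intro H.generate_is_subgroup) simp
    have "x [^]\<^bsub>?H\<^esub> (p ^ k) = \<one>\<^bsub>?H\<^esub>"
      using x(2) by (simp flip: nat_pow_consistent)
    then have "H.ord x dvd p ^ k"
      using H.pow_eq_id[of x "p ^ k"] xC by simp
    then obtain j where "card (generate ?H {x}) = p ^ j"
      using p xC H.generate_pow_card[of x] by (auto simp: divides_primepow_nat)
    then obtain g where g: "g \<in> ?C" "\<forall>q\<in>generate ?H {x}. g \<otimes> q \<otimes> inv\<^bsub>?H\<^esub> g \<in> Q"
      using H.p_subgroup_conj_into_sylow[OF finH p Q(1) _ gen] index m(2) by auto
    have "g \<otimes> x \<otimes> inv g \<in> Q"
      using g generate.incl[of x "{x}" ?H] m_inv_consistent[OF C g(1)] by auto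
    moreover have "g \<otimes> x \<otimes> inv g = x"
      using g(1) x(1) by (auto simp: elt_centralizer_def m_assoc simp flip: m_assoc)
        (metis inv_closed m_assoc r_inv r_one)
    ultimately show ?thesis by simp
  qed
  moreover have "x \<notin> derived G Q"
  proof
    assume xD: "x \<in> derived G Q"
    obtain g where g: "g \<in> carrier G" "\<forall>q\<in>Q. g \<otimes> q \<otimes> inv g \<in> P"
      using p_subgroup_conj_into_sylow[OF fin p P QG Q(2)] by blast
    interpret c: group_hom G G "\<lambda>x. g \<otimes> x \<otimes> inv g" by (rule conjugation_group_hom[OF g(1)])
    have "g \<otimes> x \<otimes> inv g \<in> derived G ((\<lambda>x. g \<otimes> x \<otimes> inv g) ` Q)"
      using xD c.derived_img[OF subgroup.subset[OF QG]] by blast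
    also have "\<dots> \<subseteq> derived G P"
      using g(2) by (intro mono_derived) auto
    finally show False using conj g(1) by blast
  qed
  ultimately show ?thesis
    using centralizer_p_elementsI[OF p x Q(1)] index m(2) by blast
qed

section \<open>Regular elements whose centralizer has a \<open>p\<close>-quotient\<close>

lemma (in group) group_exponent:
  assumes "finite (carrier G)"
  shows "0 < group_exponent G" and "\<And>x. x \<in> carrier G \<Longrightarrow> x [^] group_exponent G = \<one>"
    and "0 < n \<Longrightarrow> (\<And>x. x \<in> carrier G \<Longrightarrow> x [^] n = \<one>) \<Longrightarrow> group_exponent G \<le> n"
proof -
  have "0 < order G \<and> (\<forall>x\<in>carrier G. x [^] order G = \<one>)"
    using assms order_gt_0_iff_finite pow_order_eq_1 by blast
  then have "0 < group_exponent G \<and> (\<forall>x\<in>carrier G. x [^] group_exponent G = \<one>)"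
    unfolding group_exponent_def by (rule LeastI)
  then show "0 < group_exponent G" and "\<And>x. x \<in> carrier G \<Longrightarrow> x [^] group_exponent G = \<one>" by auto
  show "group_exponent G \<le> n" if "0 < n" "\<And>x. x \<in> carrier G \<Longrightarrow> x [^] n = \<one>"
    unfolding group_exponent_def using that by (intro Least_le) auto
qed

theorem proposition2p4:
  fixes K :: "('k, 'c) ring_scheme"
    and L :: "('a, 'b) monoid_scheme"
    and p :: nat
    and \<alpha> :: "'a \<times> 'a \<Rightarrow> 'k"
    and P :: "'a set"
  assumes "field K" and "Factorial_Ring.prime p" and "ring_characteristic K = p"
    and "group L" and "finite (carrier L)" and "p dvd order L"
    and "\<alpha> \<in> two_cocycles L (units_of K)" and "normalized_cocycle L (units_of K) \<alpha>"
    and "sylow_subgroup p P L"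
    and "non_p_perfect p L
       \<or> P \<lhd> L
       \<or> \<not> group_center (L\<lparr>carrier := P\<rparr>) \<subseteq> derived L P
       \<or> group_exponent (L\<lparr>carrier := derived L P\<rparr>) < group_exponent (L\<lparr>carrier := P\<rparr>)
       \<or> metacyclic (L\<lparr>carrier := P\<rparr>)"
  shows "centralizer_p_elements p L \<inter> regular_elements L \<alpha> \<noteq> {}"
proof -
  interpret K: field K by fact
  interpret L: group L by fact
  note p = assms(2) and fin = assms(5)
  let ?P = "L\<lparr>carrier := P\<rparr>"
  have P: "subgroup P L" and cardP: "card P = p ^ multiplicity p (order L)"
    using assms(9) by (auto simp: sylow_subgroup_def)
  interpret P: group ?P by (rule L.subgroup_imp_group[OF P])
  have ord: "order L \<noteq> 0" using fin L.order_gt_0_iff_finite by auto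
  have indexP: "\<not> p dvd subgroup_index L P"
  proof
    assume "p dvd subgroup_index L P"
    then have "p * p ^ multiplicity p (order L) dvd order L"
      using L.lagrange[OF P] cardP by (metis dvd_refl mult_dvd_mono subgroup_index_def)
    then show False
      using multiplicity_geI[of "order L" p "Suc (multiplicity p (order L))"] ord p not_prime_unit by fastforce
  qed
  have "multiplicity p (order L) \<noteq> 0"
    using multiplicity_eq_zero_iff[OF ord, of p] assms(6) p not_prime_unit by blast
  then obtain n where "multiplicity p (order L) = Suc n"
    using not0_implies_Suc by blast
  then have n: "order ?P = p ^ Suc n"
    using cardP by (simp add: order_def[of ?P] del: power_Suc)
  have PL: "x \<in> carrier L" if "x \<in> P" for x using that subgroup.subset[OF P] by blast
  have pow: "x [^]\<^bsub>L\<^esub> (p ^ Suc n) = \<one>\<^bsub>L\<^esub>" if "x \<in> P" for x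
    using P.pow_order_eq_1[of x] that n by (simp flip: L.nat_pow_consistent del: power_Suc)
  have derived_P: "derived ?P P = derived L P"
    by (rule L.derived_consistent[OF subset_refl P])
  have regular: "x \<in> regular_elements L \<alpha>"
    if "x \<in> carrier L" "x [^]\<^bsub>L\<^esub> (p ^ k) = \<one>\<^bsub>L\<^esub>" for x k
    using K.units_comm_group assms(7) K.unit_pow_prime_power_eq_one[OF p assms(3)] that
    by (rule L.p_element_regular)
  \<comment> \<open>The common step of the exponent and the metacyclic case.\<close>
  have exponent: "\<exists>x. x \<in> centralizer_p_elements p L \<inter> regular_elements L \<alpha>"
    if e: "\<And>y. y \<in> derived L P \<Longrightarrow> y [^]\<^bsub>L\<^esub> e = \<one>\<^bsub>L\<^esub>"
      and x: "x \<in> P" "x [^]\<^bsub>L\<^esub> e \<noteq> \<one>\<^bsub>L\<^esub>" for e :: nat and x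
  proof -
    have "g \<otimes>\<^bsub>L\<^esub> x \<otimes>\<^bsub>L\<^esub> inv\<^bsub>L\<^esub> g \<notin> derived L P" if g: "g \<in> carrier L" for g
    proof
      assume "g \<otimes>\<^bsub>L\<^esub> x \<otimes>\<^bsub>L\<^esub> inv\<^bsub>L\<^esub> g \<in> derived L P"
      interpret c: group_hom L L "\<lambda>x. g \<otimes>\<^bsub>L\<^esub> x \<otimes>\<^bsub>L\<^esub> inv\<^bsub>L\<^esub> g"
        by (rule L.conjugation_group_hom[OF g])
      have "g \<otimes>\<^bsub>L\<^esub> (x [^]\<^bsub>L\<^esub> e) \<otimes>\<^bsub>L\<^esub> inv\<^bsub>L\<^esub> g = g \<otimes>\<^bsub>L\<^esub> \<one>\<^bsub>L\<^esub> \<otimes>\<^bsub>L\<^esub> inv\<^bsub>L\<^esub> g"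
        using e[OF \<open>g \<otimes>\<^bsub>L\<^esub> x \<otimes>\<^bsub>L\<^esub> inv\<^bsub>L\<^esub> g \<in> derived L P\<close>] c.hom_nat_pow[OF PL[OF x(1)]] g by simp
      then have "x [^]\<^bsub>L\<^esub> e = \<one>\<^bsub>L\<^esub>"
        using L.conjugation_is_inj[OF g] PL[OF x(1)] by blast
      with x(2) show False ..
    qed
    then show ?thesis
      using L.conj_avoids_derived_sylow_imp_centralizer_p_element[OF fin p P indexP PL[OF x(1)] pow[OF x(1)]]
        regular[OF PL[OF x(1)] pow[OF x(1)]] by blast
  qed
  from assms(10) have "\<exists>x. x \<in> centralizer_p_elements p L \<inter> regular_elements L \<alpha>"
  proof (elim disjE)
    assume "non_p_perfect p L"
    then have R: "p_residual p L \<noteq> carrier L" by (auto simp: non_p_perfect_def)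
    obtain k where "subgroup_index L (p_residual p L) = p ^ k"
      using L.p_residual_least(2)[OF fin p] by blast
    then have "p dvd subgroup_index L (derived L (carrier L))"
      by (rule L.p_quotient_imp_p_dvd_abelianization[OF p L.p_residual_least(1)[OF fin p] _ R])
    moreover have "elt_centralizer L \<one>\<^bsub>L\<^esub> = carrier L"
      by (auto simp: elt_centralizer_def)
    ultimately have "\<one>\<^bsub>L\<^esub> \<in> centralizer_p_elements p L"
      by (simp add: centralizer_p_elements_def)
    then show ?thesis using regular[of "\<one>\<^bsub>L\<^esub>" 0] by auto
  next
    assume normal: "P \<lhd> L"
    have "derived L P \<noteq> P"
      using P.p_group_not_perfect[OF p n] derived_P by simp
    then obtain x where x: "x \<in> P" "x \<notin> derived L P"
      using L.derived_incl[OF subset_refl P] by blast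
    have "g \<otimes>\<^bsub>L\<^esub> x \<otimes>\<^bsub>L\<^esub> inv\<^bsub>L\<^esub> g \<notin> derived L P" if g: "g \<in> carrier L" for g
    proof
      assume "g \<otimes>\<^bsub>L\<^esub> x \<otimes>\<^bsub>L\<^esub> inv\<^bsub>L\<^esub> g \<in> derived L P"
      then have "inv\<^bsub>L\<^esub> g \<otimes>\<^bsub>L\<^esub> (g \<otimes>\<^bsub>L\<^esub> x \<otimes>\<^bsub>L\<^esub> inv\<^bsub>L\<^esub> g) \<otimes>\<^bsub>L\<^esub> g \<in> derived L P"
        by (rule normal.inv_op_closed1[OF L.derived_is_normal[OF normal] g])
      then show False
        using x(2) g PL[OF x(1)] L.conjugation_is_surj[of "inv\<^bsub>L\<^esub> g" x] by simp
    qed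
    then show ?thesis
      using L.conj_avoids_derived_sylow_imp_centralizer_p_element[OF fin p P indexP PL[OF x(1)] pow[OF x(1)]]
        regular[OF PL[OF x(1)] pow[OF x(1)]] by blast
  next
    assume "\<not> group_center ?P \<subseteq> derived L P"
    then obtain z where z: "z \<in> P" "z \<notin> derived L P" "\<And>y. y \<in> P \<Longrightarrow> z \<otimes>\<^bsub>L\<^esub> y = y \<otimes>\<^bsub>L\<^esub> z"
      by (auto simp: group_center_def)
    \<comment> \<open>As \<open>z\<close> is central in \<open>P\<close>, the group \<open>P\<close> itself serves as the Sylow subgroup of \<open>C\<^sub>L(z)\<close>;
      conjugates of \<open>z\<close> may well lie in \<open>P'\<close>.\<close>
    let ?C = "elt_centralizer L z"
    let ?H = "L\<lparr>carrier := ?C\<rparr>"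
    note C = L.elt_centralizer_subgroup[OF PL[OF z(1)]]
    have PC: "subgroup P ?H"
      using z(3) PL by (intro L.subgroup_incl[OF P C]) (auto simp: elt_centralizer_def)
    have "subgroup_index L ?C * subgroup_index ?H P * card P = subgroup_index L P * card P"
      using L.lagrange[OF P] L.lagrange[OF C] group.lagrange[OF L.subgroup_imp_group[OF C] PC]
      by (simp add: subgroup_index_def order_def mult.assoc)
    then have "subgroup_index ?H P dvd subgroup_index L P"
      using cardP prime_gt_0_nat[OF p] by (metis dvd_triv_right mult_cancel2 power_not_zero not_less0)
    then have "\<not> p dvd subgroup_index ?H P"
      using indexP dvd_trans by blast
    then show ?thesis
      using L.centralizer_p_elementsI[OF p PL[OF z(1)] pow[OF z(1)] PC _ z(1,2)]
        regular[OF PL[OF z(1)] pow[OF z(1)]] by blast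
  next
    let ?D = "L\<lparr>carrier := derived L P\<rparr>"
    assume less: "group_exponent ?D < group_exponent ?P"
    have D: "subgroup (derived L P) L"
      by (rule L.derived_is_subgroup[OF subgroup.subset[OF P]])
    interpret D: group ?D by (rule L.subgroup_imp_group[OF D])
    have finD: "finite (carrier ?D)" and finP: "finite (carrier ?P)"
      using finite_subset[OF subgroup.subset[OF D] fin] finite_subset[OF subgroup.subset[OF P] fin] by simp_all
    let ?e = "group_exponent ?D"
    have "\<not> (\<forall>x\<in>P. x [^]\<^bsub>?P\<^esub> ?e = \<one>\<^bsub>?P\<^esub>)"
    proof
      assume "\<forall>x\<in>P. x [^]\<^bsub>?P\<^esub> ?e = \<one>\<^bsub>?P\<^esub>"
      then have "group_exponent ?P \<le> ?e"
        by (intro P.group_exponent(3)[OF finP D.group_exponent(1)[OF finD]]) simp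
      with less show False by simp
    qed
    then obtain x where x: "x \<in> P" "x [^]\<^bsub>L\<^esub> ?e \<noteq> \<one>\<^bsub>L\<^esub>"
      using L.nat_pow_consistent[of _ ?e P] by auto
    have "y [^]\<^bsub>L\<^esub> ?e = \<one>\<^bsub>L\<^esub>" if "y \<in> derived L P" for y
      using D.group_exponent(2)[OF finD, of y] that L.nat_pow_consistent[of y ?e "derived L P"] by simp
    then show ?thesis
      using x by (rule exponent)
  next
    assume "metacyclic ?P"
    then obtain e :: nat and x where "\<forall>y\<in>derived ?P P. y [^]\<^bsub>?P\<^esub> e = \<one>\<^bsub>?P\<^esub>"
        "x \<in> P" "x [^]\<^bsub>?P\<^esub> e \<noteq> \<one>\<^bsub>?P\<^esub>"
      using P.metacyclic_p_group_exponent_derived[OF p n] by auto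
    then show ?thesis
      using derived_P by (intro exponent[of e x]) (auto simp flip: L.nat_pow_consistent)
  qed
  then show ?thesis by blast
qed

end
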